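(* Let $E,A\in\mathbb{R}^{n\times n}$, $B\in\mathbb{R}^{n\times m}$, $C\in\mathbb{R}^{m\times n}$, and suppose that the descriptor system $E\dot x=Ax+Bu,\ y=Cx$ admits a pH representation. Then the following statements are equivalent. (a) There exists $K\in\mathbb{R}^{m\times m}$ such that the pair $(E,A-BKC)$ is regular, impulse-free and asymptotically stable, and the closed-loop system $E\dot x=(A-BKC)x+Bv,\ y=Cx$ admits a pH representation. (b) The following two conditions hold: (i) $$\operatorname{rank}\begin{bmatrix}E&A\\0&E\\0&C\end{bmatrix}=n+\operatorname{rank}(E);$$ (ii) for all $s\in\mathbb{C}$ with $\Re(s)=0$, $$\operatorname{rank}\begin{bmatrix}sE-A&B\end{bmatrix}=\operatorname{rank}\begin{bmatrix}sE-A\\C\end{bmatrix}=n.$$ Moreover, whenever (b) holds, $K$ in (a) may be chosen as any symmetric positive definite matrix in $\mathbb{R}^{m\times m}$; that is, every symmetric positive definite $K$ has the properties required in (a).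
   Context: All matrices are real. $M\ge 0$ means $M$ is symmetric positive semidefinite. A pH (port-Hamiltonian) representation of the descriptor system $E\dot x=Ax+Bu,\ y=Cx$ (with $E,A\in\mathbb{R}^{n\times n}$, $B\in\mathbb{R}^{n\times m}$, $C\in\mathbb{R}^{m\times n}$) is a tuple of matrices $J,R,Q\in\mathbb{R}^{n\times n}$, $G,P\in\mathbb{R}^{n\times m}$ with $$A=(J-R)Q,\quad B=G-P,\quad C=(G+P)^TQ,$$ $$Q^TE=E^TQ\ge 0,\quad Q^TJQ=-(Q^TJQ)^T,\quad Q^TRQ\ge 0,\quad Q^TP=0.$$ A system admits a pH representation if at least one such tuple exists. For a closed-loop system, the definition is applied to its own coefficient matrices (here $E$, $A-BKC$, $B$, $C$). A pair $(E,A)$ is regular if $\det(sE-A)\ne0$ for some $s\in\mathbb{C}$; regular and impulse-free if $\deg(\det(sE-A))=\operatorname{rank}(E)$ (the zero polynomial having degree $-\infty$); regular and asymptotically stable if all roots $s\in\mathbb C$ of $\det(sE-A)=0$ have strictly negative real part. *)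

theory Defs
  imports "HOL-Analysis.Analysis" "HOL-Computational_Algebra.Polynomial"
begin

definition psd :: "real^'n^'n \<Rightarrow> bool" where
  "psd M \<longleftrightarrow> transpose M = M \<and> (\<forall>x. 0 \<le> x \<bullet> (M *v x))"

definition spd :: "real^'n^'n \<Rightarrow> bool" where
  "spd M \<longleftrightarrow> transpose M = M \<and> (\<forall>x. x \<noteq> 0 \<longrightarrow> 0 < x \<bullet> (M *v x))"

text \<open>Concatenated index sets are sum types; \<open>hcat X Y\<close> is \<open>[X  Y]\<close>, and \<open>vcat X Y\<close> is
  \<open>X\<close> stacked on top of \<open>Y\<close>.\<close>

definition hcat :: "'a^'p^'k \<Rightarrow> 'a^'q^'k \<Rightarrow> 'a^('p + 'q)^'k" where
  "hcat X Y = (\<chi> i j. case j of Inl a \<Rightarrow> X $ i $ a | Inr b \<Rightarrow> Y $ i $ b)"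

definition vcat :: "'a^'k^'p \<Rightarrow> 'a^'k^'q \<Rightarrow> 'a^'k^('p + 'q)" where
  "vcat X Y = (\<chi> i. case i of Inl a \<Rightarrow> X $ a | Inr b \<Rightarrow> Y $ b)"

abbreviation cmat :: "real^'q^'p \<Rightarrow> complex^'q^'p" where
  "cmat \<equiv> map_matrix complex_of_real"

definition pencil :: "real^'n^'n \<Rightarrow> real^'n^'n \<Rightarrow> complex \<Rightarrow> complex^'n^'n" where
  "pencil E A s = map_matrix ((*) s) (cmat E) - cmat A"

text \<open>The entries are the linear polynomials \<open>s E\<^sub>i\<^sub>j - A\<^sub>i\<^sub>j\<close> in \<open>s\<close>, so this is \<open>det (s E - A)\<close> as a polynomial.\<close>

definition pencil_poly :: "real^'n^'n \<Rightarrow> real^'n^'n \<Rightarrow> complex poly" where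
  "pencil_poly E A = det (\<chi> i j. [:- complex_of_real (A $ i $ j), complex_of_real (E $ i $ j):])"

lemma poly_pencil_poly: "poly (pencil_poly E A) s = det (pencil E A s)"
  by (simp add: pencil_poly_def pencil_def det_def poly_sum poly_prod algebra_simps)

definition regular :: "real^'n^'n \<Rightarrow> real^'n^'n \<Rightarrow> bool" where
  "regular E A \<longleftrightarrow> (\<exists>s. det (pencil E A s) \<noteq> 0)"

text \<open>The zero polynomial has degree \<open>-\<infinity>\<close> by convention, but \<open>degree 0 = 0\<close> here; hence it is
  excluded explicitly.\<close>

definition regular_impulse_free :: "real^'n^'n \<Rightarrow> real^'n^'n \<Rightarrow> bool" where
  "regular_impulse_free E A \<longleftrightarrow> pencil_poly E A \<noteq> 0 \<and> degree (pencil_poly E A) = rank E"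

definition regular_asymp_stable :: "real^'n^'n \<Rightarrow> real^'n^'n \<Rightarrow> bool" where
  "regular_asymp_stable E A \<longleftrightarrow> regular E A \<and> (\<forall>s. det (pencil E A s) = 0 \<longrightarrow> Re s < 0)"

text \<open>The system is \<open>E x' = A x + B u, y = C x\<close>.\<close>

definition pH_representation ::
  "real^'n^'n \<Rightarrow> real^'n^'n \<Rightarrow> real^'m^'n \<Rightarrow> real^'n^'m \<Rightarrow>
   real^'n^'n \<Rightarrow> real^'n^'n \<Rightarrow> real^'n^'n \<Rightarrow> real^'m^'n \<Rightarrow> real^'m^'n \<Rightarrow> bool" where
  "pH_representation E A B C J R Q G P \<longleftrightarrow>
     A = (J - R) ** Q \<and>
     B = G - P \<and>
     C = transpose (G + P) ** Q \<and>
     transpose Q ** E = transpose E ** Q \<and> psd (transpose Q ** E) \<and>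
     transpose Q ** J ** Q = - transpose (transpose Q ** J ** Q) \<and>
     psd (transpose Q ** R ** Q) \<and>
     transpose Q ** P = 0"

definition admits_pH ::
  "real^'n^'n \<Rightarrow> real^'n^'n \<Rightarrow> real^'m^'n \<Rightarrow> real^'n^'m \<Rightarrow> bool" where
  "admits_pH E A B C \<longleftrightarrow> (\<exists>J R Q G P. pH_representation E A B C J R Q G P)"

text \<open>Output feedback \<open>u = - K y + v\<close> turns the system into \<open>E x' = (A - B K C) x + B v, y = C x\<close>.\<close>

definition good_feedback ::
  "real^'n^'n \<Rightarrow> real^'n^'n \<Rightarrow> real^'m^'n \<Rightarrow> real^'n^'m \<Rightarrow> real^'m^'m \<Rightarrow> bool" where
  "good_feedback E A B C K \<longleftrightarrow>
     regular E (A - B ** K ** C) \<and>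
     regular_impulse_free E (A - B ** K ** C) \<and>
     regular_asymp_stable E (A - B ** K ** C) \<and>
     admits_pH E (A - B ** K ** C) B C"

text \<open>The block matrix has the rows \<open>[E  A]\<close>, \<open>[0  E]\<close>, \<open>[0  C]\<close>.\<close>

definition rank_condition_infinity :: "real^'n^'n \<Rightarrow> real^'n^'n \<Rightarrow> real^'n^'m \<Rightarrow> bool" where
  "rank_condition_infinity E A C \<longleftrightarrow>
     rank (vcat (hcat E A) (vcat (hcat 0 E) (hcat (0 :: real^'n^'m) C))) = CARD('n) + rank E"

definition rank_condition_imaginary_axis ::
  "real^'n^'n \<Rightarrow> real^'n^'n \<Rightarrow> real^'m^'n \<Rightarrow> real^'n^'m \<Rightarrow> bool" where
  "rank_condition_imaginary_axis E A B C \<longleftrightarrow>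
     (\<forall>s. Re s = 0 \<longrightarrow>
        rank (hcat (pencil E A s) (cmat B)) = CARD('n) \<and>
        rank (vcat (pencil E A s) (cmat C)) = CARD('n))"

end

theory Submission
  imports Defs
begin

text \<open>A pH representation forces \<open>C = B\<^sup>T Q\<close>, so the feedback \<open>K\<close> merely adds \<open>B K B\<^sup>T\<close> to \<open>R\<close>.
  If (ii) holds at \<open>s = 0\<close>, then \<open>Q\<close> is invertible. For \<open>Re s \<ge> 0\<close> and \<open>x\<close> in the kernel of the
  closed-loop pencil, the energy balance
  \<open>Re s (x\<^sup>* Q\<^sup>T E x) = - x\<^sup>* (Q\<^sup>T R Q + C\<^sup>T K C) x\<close> gives \<open>C x = 0\<close> and, if \<open>Re s > 0\<close>, also \<open>E x = 0\<close>;
  so \<open>x = 0\<close> by (ii).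
  The pencil is impulse-free iff no \<open>x \<noteq> 0\<close> satisfies \<open>E x = 0\<close> and \<open>A x \<in> im E\<close>, while (i) says the
  same for those \<open>x\<close> with \<open>C x = 0\<close>. The energy balance again yields \<open>C x = 0\<close>, because
  \<open>Q\<^sup>T E\<close> is symmetric. Conversely, feedback does not change a pencil on the kernel of \<open>C\<close>, nor on
  the left kernel of \<open>B\<close>.\<close>

section \<open>Rank and kernel\<close>

lemma det_nonzero_iff_ker:
  fixes M :: "'a::field^'n^'n"
  shows "det M \<noteq> 0 \<longleftrightarrow> (\<forall>x. M *v x = 0 \<longrightarrow> x = 0)"
  by (metis invertible_det_nz invertible_left_inverse matrix_left_invertible_ker)

lemma rank_eq_columns_iff_ker:
  fixes M :: "'a::field^'n^'k"
  shows "rank M = CARD('n) \<longleftrightarrow> (\<forall>x. M *v x = 0 \<longrightarrow> x = 0)"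
proof -
  have "rank M = CARD('n) \<longleftrightarrow> vec.span (rows M) = UNIV"
    using vec.dim_eq_full[of "rows M"] vec_dim_card[where 'a='a and 'n='n]
    by (simp add: row_rank_def_gen vec.dimension_def)
  then show ?thesis
    by (simp add: matrix_left_invertible_span_rows_gen [symmetric] matrix_left_invertible_ker)
qed

text \<open>The map \<open>?f\<close> sends the standard basis to the rows of \<open>M\<close>;
  being injective, it preserves the dimension \<open>CARD('k)\<close>.\<close>

lemma rank_eq_rows_if_left_ker:
  fixes M :: "'a::field^'n^'k"
  assumes "\<And>v. v v* M = 0 \<Longrightarrow> v = 0"
  shows "rank M = CARD('k)"
proof -
  let ?f = "\<lambda>v. v v* M"
  have "?f = (*v) (transpose M)"
    by (simp add: fun_eq_iff)
  then have f: "Vector_Spaces.linear (*s) (*s) ?f"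
    using matrix_vector_mul_linear_gen[of "transpose M"] by (simp only:)
  have inj: "inj ?f"
    using assms vec.linear_inj_iff_eq_0[OF f] by blast
  have row: "row i M = ?f (axis i 1)" for i
    by (simp add: row_def vector_matrix_mult_def axis_def vec_eq_iff
        mult_delta_left mult_delta_right sum.delta)
  have "rows M = ?f ` cart_basis"
    by (auto simp: rows_def cart_basis_def row)
  then have "rank M = vec.dim (?f ` cart_basis)"
    by (simp add: row_rank_def_gen)
  also have "\<dots> = vec.dim (cart_basis :: ('a^'k) set)"
    by (rule vec.dim_image_eq[OF f]) (use inj in \<open>blast intro: inj_on_subset\<close>)
  also have "\<dots> = CARD('k)"
    by (metis span_cart_basis vec.dim_span vec_dim_card)
  finally show ?thesis .
qed

text \<open>The kernel is the orthogonal complement of the row space.\<close>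

lemma rank_nullity:
  fixes M :: "real^'n^'k"
  shows "dim {x. M *v x = 0} + rank M = CARD('n)"
proof -
  have "{x. M *v x = 0} = {y \<in> UNIV. \<forall>x \<in> span (rows M). orthogonal x y}"
  proof safe
    fix y assume y: "\<forall>x \<in> span (rows M). orthogonal x y"
    have "M $ i \<bullet> y = 0" for i
      using y by (auto simp: orthogonal_def rows_def row_def intro!: span_base)
    then show "M *v y = 0"
      by (simp add: matrix_mult_dot vec_eq_iff)
  qed (auto dest: orthogonal_nullspace_rowspace simp: orthogonal_commute)
  then show ?thesis
    using dim_subspace_orthogonal_to_vectors[of "span (rows M)" UNIV]
    by (simp add: row_rank_def dim_span)
qed

lemma subspace_null_space: "subspace {x. (M :: real^'n^'k) *v x = 0}"
  by (simp add: subspace_def matrix_vector_right_distrib matrix_vector_mult_scaleR)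

text \<open>The columns of \<open>T\<close> form a basis extending a basis of the kernel of
  \<open>E\<close>, and \<open>I\<close> marks the added vectors. The columns of
  \<open>E ** T\<close> outside \<open>I\<close> then vanish, which makes the degree of the pencil
  determinant visible column by column.\<close>

lemma column_compression:
  fixes E :: "real^'n^'n"
  obtains T :: "real^'n^'n" and I :: "'n set"
  where "invertible T" "card I = rank E"
    "\<And>x. (E ** T) *v x = 0 \<longleftrightarrow> (\<forall>i\<in>I. x $ i = 0)"
proof -
  let ?N = "{x. E *v x = 0}"
  obtain B0 where B0: "B0 \<subseteq> ?N" "independent B0" "?N \<subseteq> span B0" "card B0 = dim ?N"
    by (rule basis_exists)
  obtain B where B: "B0 \<subseteq> B" "independent B" "UNIV \<subseteq> span B"
    using maximal_independent_subset_extend[OF subset_UNIV B0(2)] by metis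
  have finB: "finite B"
    using B(2) independent_imp_finite by blast
  have "card B = CARD('n)"
    using B dim_eq_card_independent[OF B(2)] dim_span[of B] by (simp add: top.extremum_unique)
  then obtain b :: "'n \<Rightarrow> real^'n" where b: "bij_betw b UNIV B"
    using finB finite_same_card_bij[of "UNIV :: 'n set" B] by auto
  define T :: "real^'n^'n" where "T = (\<chi> i j. b j $ i)"
  define I where "I = {j. b j \<notin> B0}"
  have T_axis: "T *v axis j 1 = b j" for j
    by (simp add: T_def matrix_vector_mult_def axis_def vec_eq_iff if_distrib sum.delta cong: if_cong)
  have "surj ((*v) T)"
  proof -
    have "B \<subseteq> range ((*v) T)"
    proof
      fix c assume "c \<in> B"
      then obtain j where "c = b j"
        using b by (auto simp: bij_betw_def)
      then have "c = T *v axis j 1"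
        by (simp add: T_axis)
      then show "c \<in> range ((*v) T)"
        by (rule range_eqI)
    qed
    moreover have "subspace (range ((*v) T))"
      by (simp add: linear_subspace_image)
    ultimately show ?thesis
      using B(3) span_minimal by blast
  qed
  then have inv: "invertible T"
    by (simp add: invertible_right_inverse matrix_right_invertible_surjective)
  then have inj: "inj ((*v) T)"
    by (simp add: inj_matrix_vector_mult)
  have "card (- I) = card B0"
  proof -
    have "b ` (- I) = B0"
      using b B(1) unfolding I_def bij_betw_def by blast
    moreover have "inj_on b (- I)"
      using b by (auto simp: bij_betw_def intro: inj_on_subset)
    ultimately show ?thesis
      by (metis card_image)
  qed
  then have card: "card I = rank E"
    using rank_nullity[of E] B0(4) card_Diff_subset[of I UNIV] card_mono[of UNIV I]
    by (simp add: Compl_eq_Diff_UNIV)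
  have "(E ** T) *v x = 0 \<longleftrightarrow> (\<forall>i\<in>I. x $ i = 0)" for x
  proof
    assume "(E ** T) *v x = 0"
    then have x: "T *v x \<in> span B0"
      using B0(3) by (auto simp: matrix_vector_mul_assoc)
    let ?V = "{y. \<forall>i\<in>I. y $ i = 0}"
    have "B0 \<subseteq> (*v) T ` ?V"
    proof
      fix c assume c: "c \<in> B0"
      then obtain j where j: "c = b j"
        using B(1) b by (auto simp: bij_betw_def)
      then have "axis j 1 \<in> ?V"
        using c by (auto simp: I_def axis_def)
      then show "c \<in> (*v) T ` ?V"
        using T_axis[of j] j by (intro image_eqI[of _ _ "axis j 1"]) auto
    qed
    moreover have "subspace ((*v) T ` ?V)"
      by (intro linear_subspace_image matrix_vector_mul_linear) (simp add: subspace_def)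
    ultimately have "span B0 \<subseteq> (*v) T ` ?V"
      by (rule span_minimal)
    then obtain y where "y \<in> ?V" "T *v x = T *v y"
      using x by blast
    then show "\<forall>i\<in>I. x $ i = 0"
      using injD[OF inj] by blast
  next
    assume x: "\<forall>i\<in>I. x $ i = 0"
    have "T *v x = (\<Sum>j\<in>UNIV. x $ j *\<^sub>R b j)"
      by (simp add: T_def matrix_vector_mult_def vec_eq_iff mult.commute)
    also have "E *v \<dots> = (\<Sum>j\<in>UNIV. x $ j *\<^sub>R (E *v b j))"
      by (simp add: linear_sum[OF matrix_vector_mul_linear] matrix_vector_mult_scaleR)
    also have "\<dots> = 0"
      using x B0(1) by (intro sum.neutral) (auto simp: I_def)
    finally show "(E ** T) *v x = 0"
      by (simp add: matrix_vector_mul_assoc)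
  qed
  then show thesis
    using that inv card by blast
qed

section \<open>The degree of the pencil determinant\<close>

text \<open>Only index \<open>m\<close> survives in the convolution: a smaller index exceeds the
  bound for \<open>q\<close>, a larger one the bound for \<open>p\<close>.\<close>

lemma coeff_mult_degree_bounds:
  fixes p q :: "'a::comm_semiring_1 poly"
  assumes "degree p \<le> m" "degree q \<le> n"
  shows "coeff (p * q) (m + n) = coeff p m * coeff q n"
proof -
  have "coeff p i * coeff q (m + n - i) = 0" if "i \<noteq> m" "i \<le> m + n" for i
    using that assms by (cases "i < m") (auto simp: coeff_eq_0)
  then have "coeff (p * q) (m + n) = (\<Sum>i\<in>{m}. coeff p i * coeff q (m + n - i))"
    unfolding coeff_mult by (intro sum.mono_neutral_right) auto
  then show ?thesis by simp
qed

lemma coeff_prod_degree_bounds: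
  fixes f :: "'i \<Rightarrow> 'a::comm_semiring_1 poly"
  assumes "finite S" "\<And>i. i \<in> S \<Longrightarrow> degree (f i) \<le> d i"
  shows "degree (prod f S) \<le> sum d S \<and> coeff (prod f S) (sum d S) = (\<Prod>i\<in>S. coeff (f i) (d i))"
  using assms
proof (induction S rule: finite_induct)
  case (insert i S)
  then have "degree (f i) \<le> d i" "degree (prod f S) \<le> sum d S"
    "coeff (prod f S) (sum d S) = (\<Prod>i\<in>S. coeff (f i) (d i))"
    by auto
  then show ?case
    using insert.hyps coeff_mult_degree_bounds[of "f i" "d i" "prod f S" "sum d S"]
      degree_mult_le[of "f i" "prod f S"]
    by simp
qed simp

text \<open>Each Leibniz term takes one entry from every column, so the column bounds add up and the
  coefficients at these bounds multiply to a Leibniz term again.\<close>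

lemma coeff_det_degree_bounds:
  fixes P :: "'a::comm_ring_1 poly^'n^'n"
  assumes "\<And>i j. degree (P $ i $ j) \<le> d j"
  shows "degree (det P) \<le> sum d UNIV"
    and "coeff (det P) (sum d UNIV) = det (\<chi> i j. coeff (P $ i $ j) (d j))"
proof -
  have prod: "degree (\<Prod>i\<in>UNIV. P $ p i $ i) \<le> sum d UNIV \<and>
      coeff (\<Prod>i\<in>UNIV. P $ p i $ i) (sum d UNIV) = (\<Prod>i\<in>UNIV. coeff (P $ p i $ i) (d i))" for p
    using assms by (intro coeff_prod_degree_bounds) auto
  \<comment> \<open>Transposing makes the products run over column indices, to which the bounds
    \<open>d\<close> refer.\<close>
  have det: "det M = (\<Sum>p | p permutes UNIV. of_int (sign p) * (\<Prod>i\<in>UNIV. M $ p i $ i))"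
    for M :: "'b::comm_ring_1^'n^'n"
    by (subst det_transpose[symmetric]) (simp add: det_def transpose_def)
  have scale: "degree (of_int (sign p) * q) = degree q \<and>
      coeff (of_int (sign p) * q) k = of_int (sign p) * coeff q k" for p :: "'n \<Rightarrow> 'n" and q :: "'a poly" and k
    by (simp add: sign_def)
  show "degree (det P) \<le> sum d UNIV"
    unfolding det by (intro degree_sum_le) (auto simp: scale prod)
  show "coeff (det P) (sum d UNIV) = det (\<chi> i j. coeff (P $ i $ j) (d j))"
    unfolding det by (simp add: coeff_sum scale prod)
qed

lemma det_cmat: "det (cmat M) = complex_of_real (det M)"
  by (simp add: det_def)

lemma pencil_mult_right: "pencil (E ** T) (A ** T) s = pencil E A s ** cmat T"
  by (simp add: pencil_def matrix_matrix_mult_def vec_eq_iff sum_subtractf[symmetric]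
      sum_distrib_left algebra_simps)

text \<open>Multiplication by an invertible \<open>T\<close> changes the determinant only by a
  nonzero factor, so the degree is decided by the single coefficient \<open>det M\<close>. A nonzero
  kernel vector of \<open>M\<close> amounts to a nonzero \<open>x\<close> in the kernel of
  \<open>E\<close> that \<open>A\<close> maps into the range of \<open>E\<close>.\<close>

lemma regular_impulse_free_iff:
  fixes E A :: "real^'n^'n"
  shows "regular_impulse_free E A \<longleftrightarrow> (\<forall>x z. E *v x = 0 \<longrightarrow> A *v x = E *v z \<longrightarrow> x = 0)"
proof -
  obtain T :: "real^'n^'n" and I :: "'n set" where T: "invertible T" and card: "card I = rank E"
    and ker: "\<And>x. (E ** T) *v x = 0 \<longleftrightarrow> (\<forall>i\<in>I. x $ i = 0)"
    using column_compression[of E] by metis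
  let ?F = "E ** T" and ?H = "A ** T"
  define d :: "'n \<Rightarrow> nat" where "d j = (if j \<in> I then 1 else 0)" for j
  define M :: "real^'n^'n" where "M = (\<chi> i j. if j \<in> I then ?F $ i $ j else - (?H $ i $ j))"
  \<comment> \<open>The columns of \<open>?F\<close> outside \<open>I\<close> vanish, so \<open>det M\<close> is the coefficient of \<open>s ^ rank E\<close> in
    \<open>det (s ?F - ?H)\<close>, which has degree at most \<open>rank E\<close>.\<close>
  define \<delta> :: "real^'n \<Rightarrow> real^'n" where "\<delta> x = (\<chi> j. if j \<in> I then x $ j else 0)" for x
  let ?p = "pencil_poly E A"
  have F0: "?F $ i $ j = 0" if "j \<notin> I" for i j
  proof -
    have "?F *v axis j 1 = 0"
      using that by (auto simp: ker axis_def)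
    then show ?thesis
      by (simp add: matrix_vector_mult_basis column_def vec_eq_iff)
  qed
  have sumd: "sum d UNIV = rank E"
    by (simp add: d_def card[symmetric] sum.If_cases)
  have bounds: "degree (pencil_poly ?F ?H) \<le> rank E"
      "coeff (pencil_poly ?F ?H) (rank E) = complex_of_real (det M)"
  proof -
    let ?P = "\<chi> i j. [:- complex_of_real (?H $ i $ j), complex_of_real (?F $ i $ j):]"
    have deg: "degree (?P $ i $ j) \<le> d j" for i j
      by (simp add: d_def F0)
    show "degree (pencil_poly ?F ?H) \<le> rank E"
      using coeff_det_degree_bounds(1)[of ?P d] deg by (simp add: pencil_poly_def sumd)
    have "coeff (pencil_poly ?F ?H) (rank E) = det (\<chi> i j. coeff (?P $ i $ j) (d j))"
      using coeff_det_degree_bounds(2)[of ?P d] deg by (simp add: pencil_poly_def sumd)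
    also have "(\<chi> i j. coeff (?P $ i $ j) (d j)) = cmat M"
      by (simp add: vec_eq_iff M_def d_def)
    finally show "coeff (pencil_poly ?F ?H) (rank E) = complex_of_real (det M)"
      by (simp add: det_cmat)
  qed
  have detT: "complex_of_real (det T) \<noteq> 0"
    using T by (simp add: invertible_det_nz)
  have smult: "pencil_poly ?F ?H = smult (complex_of_real (det T)) ?p"
  proof -
    have "poly (pencil_poly ?F ?H) s = poly (smult (complex_of_real (det T)) ?p) s" for s
      by (simp add: poly_pencil_poly pencil_mult_right det_mul det_cmat)
    then show ?thesis
      using poly_eq_poly_eq_iff by blast
  qed
  have "regular_impulse_free E A \<longleftrightarrow> det M \<noteq> 0"
  proof -
    have "degree ?p \<le> rank E" and c: "coeff ?p (rank E) = 0 \<longleftrightarrow> det M = 0"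
      using bounds detT by (auto simp: smult)
    then show ?thesis
      unfolding regular_impulse_free_def
      by (metis c coeff_0 le_antisym le_degree leading_coeff_0_iff)
  qed
  moreover have "det M \<noteq> 0 \<longleftrightarrow> (\<forall>x z. E *v x = 0 \<longrightarrow> A *v x = E *v z \<longrightarrow> x = 0)"
  proof -
    \<comment> \<open>\<open>?F\<close> ignores entries outside \<open>I\<close>, so its columns in
      \<open>M\<close> already give \<open>?F *v x\<close>; the columns taken from
      \<open>- ?H\<close> see only \<open>x - \<delta> x\<close>.\<close>
    have Mx: "M *v x = ?F *v x - ?H *v (x - \<delta> x)" for x
      unfolding vec_eq_iff matrix_vector_mult_def M_def \<delta>_def
      by (auto simp: sum_subtractf[symmetric] F0 intro!: sum.cong)
    have F\<delta>: "?F *v (x - \<delta> x) = 0" for x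
      by (simp add: ker \<delta>_def)
    obtain T' where T': "T ** T' = mat 1" "T' ** T = mat 1"
      using T by (auto simp: invertible_def)
    have TT': "T *v (T' *v x) = x" for x
      by (simp add: matrix_vector_mul_assoc T')
    have T'T: "T' *v (T *v x) = x" for x
      by (simp add: matrix_vector_mul_assoc T')
    show ?thesis
      unfolding det_nonzero_iff_ker
    proof (intro iffI allI impI)
      fix x z
      assume M0: "\<forall>x. M *v x = 0 \<longrightarrow> x = 0" and x: "E *v x = 0" "A *v x = E *v z"
      define w v where "w = T' *v x" and "v = T' *v z"
      have "?F *v w = 0" "?H *v w = ?F *v v"
        using x by (simp_all add: w_def v_def TT' flip: matrix_vector_mul_assoc)
      then have w: "\<forall>i\<in>I. w $ i = 0"
        using ker by blast
      \<comment> \<open>In \<open>M *v ?y\<close> the \<open>I\<close>-part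
        \<open>\<delta> v\<close> contributes \<open>?F *v v\<close>, and \<open>w\<close>,
        supported outside \<open>I\<close>, contributes the cancelling
        \<open>- (?H *v w)\<close>.\<close>
      let ?y = "\<delta> v + w"
      have "\<delta> ?y = \<delta> v"
        using w by (simp add: \<delta>_def vec_eq_iff)
      moreover have "?F *v ?y = ?F *v v"
        using F\<delta>[of v] \<open>?F *v w = 0\<close> by (simp add: algebra_simps)
      ultimately have "M *v ?y = 0"
        using \<open>?H *v w = ?F *v v\<close> by (simp add: Mx)
      then have "?y = 0"
        using M0 by blast
      then have "w = - \<delta> v"
        by (simp add: add_eq_0_iff)
      then have "w = 0"
        using w by (auto simp: vec_eq_iff \<delta>_def)
      then show "x = 0"
        using TT'[of x] by (simp add: w_def)
    next
      fix x
      assume *: "\<forall>x z. E *v x = 0 \<longrightarrow> A *v x = E *v z \<longrightarrow> x = 0" and "M *v x = 0"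
      \<comment> \<open>The part of \<open>x\<close> outside \<open>I\<close> gives a kernel vector
        of \<open>E\<close>, and \<open>M *v x = 0\<close> exhibits \<open>T *v x\<close> as a
        preimage of \<open>A *v ?u\<close> under \<open>E\<close>.\<close>
      let ?u = "T *v (x - \<delta> x)"
      have "E *v ?u = 0" "A *v ?u = E *v (T *v x)"
        using F\<delta>[of x] \<open>M *v x = 0\<close> Mx[of x] by (simp_all add: matrix_vector_mul_assoc)
      then have "?u = 0"
        using * by blast
      then have x: "x = \<delta> x"
        using T'T[of "x - \<delta> x"] by simp
      then have "?F *v x = 0"
        using \<open>M *v x = 0\<close> Mx[of x] by simp
      then have "\<forall>i\<in>I. x $ i = 0"
        by (simp only: ker)
      then have "\<delta> x = 0"
        by (simp add: \<delta>_def vec_eq_iff)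
      then show "x = 0"
        using x by simp
    qed
  qed
  ultimately show ?thesis by blast
qed

section \<open>The rank conditions\<close>

lemma sum_UNIV_sum:
  fixes f :: "'a::finite + 'b::finite \<Rightarrow> 'c::comm_monoid_add"
  shows "(\<Sum>k\<in>UNIV. f k) = (\<Sum>a\<in>UNIV. f (Inl a)) + (\<Sum>b\<in>UNIV. f (Inr b))"
  by (simp add: sum.Plus flip: UNIV_Plus_UNIV)

lemma vcat_mult_vec_eq_0_iff:
  "vcat X Y *v x = 0 \<longleftrightarrow> X *v x = 0 \<and> Y *v x = 0"
  by (auto simp: vec_eq_iff vcat_def matrix_vector_mult_def split: sum.splits)

lemma hcat_mult_vec:
  "hcat X Y *v x = X *v (\<chi> a. x $ Inl a) + Y *v (\<chi> b. x $ Inr b)"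
  by (simp add: vec_eq_iff hcat_def matrix_vector_mult_def sum_UNIV_sum)

lemma vec_mult_hcat_eq_0_iff:
  "v v* hcat X Y = 0 \<longleftrightarrow> v v* X = 0 \<and> v v* Y = 0"
  by (simp add: vec_eq_iff hcat_def vector_matrix_mult_def split_sum_all)

text \<open>Rank-nullity turns the rank equation into equality of the dimensions of the kernels of
  the block matrix and of \<open>E\<close>. The first kernel always contains the pairs
  \<open>(z, 0)\<close> with \<open>E z = 0\<close>, so equal dimensions mean that it contains no
  others.\<close>

lemma rank_condition_infinity_iff:
  fixes E A :: "real^'n^'n" and C :: "real^'n^'m"
  shows "rank_condition_infinity E A C \<longleftrightarrow>
    (\<forall>x z. E *v x = 0 \<longrightarrow> C *v x = 0 \<longrightarrow> A *v x = E *v z \<longrightarrow> x = 0)"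
proof -
  let ?M = "vcat (hcat E A) (vcat (hcat 0 E) (hcat (0 :: real^'n^'m) C))"
  define \<iota> :: "real^'n \<Rightarrow> real^('n + 'n)"
    where "\<iota> z = (\<chi> k. case k of Inl a \<Rightarrow> z $ a | Inr b \<Rightarrow> 0)" for z
  let ?V = "\<iota> ` {z. E *v z = 0}"
  let ?N = "{w. ?M *v w = 0}"
  have lin: "linear \<iota>"
    by (rule linearI) (auto simp: \<iota>_def vec_eq_iff split: sum.splits)
  have inj: "inj \<iota>"
    by (rule injI) (auto simp: \<iota>_def vec_eq_iff split: sum.splits)
  have N: "w \<in> ?N \<longleftrightarrow> E *v (\<chi> a. w $ Inl a) + A *v (\<chi> b. w $ Inr b) = 0 \<and>
      E *v (\<chi> b. w $ Inr b) = 0 \<and> C *v (\<chi> b. w $ Inr b) = 0" for w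
    by (simp add: vcat_mult_vec_eq_0_iff hcat_mult_vec)
  have \<iota>_Inl: "(\<chi> a. \<iota> z $ Inl a) = z" and \<iota>_Inr: "(\<chi> b. \<iota> z $ Inr b) = 0" for z
    by (simp_all add: \<iota>_def vec_eq_iff)
  have sub: "?V \<subseteq> ?N"
    unfolding N image_subset_iff by (simp add: N \<iota>_Inl \<iota>_Inr)
  have dimV: "dim ?V = dim {z. E *v z = 0}"
    using inj by (intro dim_image_eq[OF lin]) (blast intro: inj_on_subset)
  have sV: "subspace ?V" and sN: "subspace ?N"
    using lin by (simp_all add: linear_subspace_image subspace_null_space)
  have "rank_condition_infinity E A C \<longleftrightarrow> dim ?N \<le> dim ?V"
    using rank_nullity[of E] rank_nullity[of ?M] dim_subset[OF sub]
    by (simp add: rank_condition_infinity_def dimV) linarith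
  also have "\<dots> \<longleftrightarrow> ?N \<subseteq> ?V"
    using subspace_dim_equal[OF sV sN sub] dim_subset by blast
  also have "\<dots> \<longleftrightarrow> (\<forall>x z. E *v x = 0 \<longrightarrow> C *v x = 0 \<longrightarrow> A *v x = E *v z \<longrightarrow> x = 0)"
  proof (intro iffI allI impI subsetI)
    fix x z
    assume NV: "?N \<subseteq> ?V" and x: "E *v x = 0" "C *v x = 0" "A *v x = E *v z"
    \<comment> \<open>The minus sign makes the first block row read
      \<open>- E z + A x = 0\<close>.\<close>
    define w :: "real^('n + 'n)" where "w = (\<chi> k. case k of Inl a \<Rightarrow> - (z $ a) | Inr b \<Rightarrow> x $ b)"
    have w: "(\<chi> a. w $ Inl a) = - z" "(\<chi> b. w $ Inr b) = x"
      by (simp_all add: w_def vec_eq_iff)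
    have "E *v (- z) = - (E *v z)"
      using matrix_vector_mult_scaleR[of E "-1" z] by simp
    then have "w \<in> ?N"
      unfolding N w using x by simp
    then obtain y where "w = \<iota> y"
      using NV by blast
    then show "x = 0"
      using w(2) \<iota>_Inr by simp
  next
    fix w
    assume *: "\<forall>x z. E *v x = 0 \<longrightarrow> C *v x = 0 \<longrightarrow> A *v x = E *v z \<longrightarrow> x = 0" and "w \<in> ?N"
    let ?z = "\<chi> a. w $ Inl a" and ?x = "\<chi> b. w $ Inr b"
    have w: "E *v ?z + A *v ?x = 0" "E *v ?x = 0" "C *v ?x = 0"
      using \<open>w \<in> ?N\<close> unfolding N by auto
    have "E *v (- ?z) = - (E *v ?z)"
      using matrix_vector_mult_scaleR[of E "-1" ?z] by simp
    then have "A *v ?x = E *v (- ?z)"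
      using w(1) by (simp add: add_eq_0_iff)
    then have "?x = 0"
      using * w by blast
    then have "E *v ?z = 0"
      using w(1) by simp
    moreover have "w = \<iota> ?z"
      using \<open>?x = 0\<close> by (auto simp: \<iota>_def vec_eq_iff split: sum.splits)
    ultimately show "w \<in> ?V"
      by blast
  qed
  finally show ?thesis .
qed

section \<open>Necessity of the rank conditions\<close>

lemma rank_condition_infinity_if_impulse_free:
  fixes E A :: "real^'n^'n" and B :: "real^'m^'n" and C :: "real^'n^'m"
  assumes "regular_impulse_free E (A - B ** K ** C)"
  shows "rank_condition_infinity E A C"
  using assms
  by (auto simp: rank_condition_infinity_iff regular_impulse_free_iff matrix_vector_mult_diff_rdistrib
      simp flip: matrix_vector_mul_assoc)

lemma pencil_output_feedback:
  fixes E A :: "real^'n^'n" and B :: "real^'m^'n" and C :: "real^'n^'m"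
  shows "pencil E (A - B ** K ** C) s = pencil E A s + cmat B ** cmat K ** cmat C"
  by (simp add: pencil_def vec_eq_iff matrix_matrix_mult_def)

lemma rank_condition_imaginary_axis_if_asymp_stable:
  fixes E A :: "real^'n^'n" and B :: "real^'m^'n" and C :: "real^'n^'m"
  assumes "regular_asymp_stable E (A - B ** K ** C)"
  shows "rank_condition_imaginary_axis E A B C"
  unfolding rank_condition_imaginary_axis_def
proof (intro allI impI conjI)
  fix s :: complex
  assume "Re s = 0"
  let ?D = "pencil E (A - B ** K ** C) s"
  have det: "det ?D \<noteq> 0"
    using assms \<open>Re s = 0\<close> unfolding regular_asymp_stable_def by force
  show "rank (vcat (pencil E A s) (cmat C)) = CARD('n)"
    unfolding rank_eq_columns_iff_ker vcat_mult_vec_eq_0_iff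
  proof (intro allI impI)
    fix x
    assume "pencil E A s *v x = 0 \<and> cmat C *v x = 0"
    then have "?D *v x = 0"
      by (simp add: pencil_output_feedback matrix_vector_mult_add_rdistrib flip: matrix_vector_mul_assoc)
    then show "x = 0"
      using det unfolding det_nonzero_iff_ker by blast
  qed
  show "rank (hcat (pencil E A s) (cmat B)) = CARD('n)"
  proof (rule rank_eq_rows_if_left_ker)
    fix v
    assume "v v* hcat (pencil E A s) (cmat B) = 0"
    \<comment> \<open>A left null vector of both blocks is one of the closed-loop pencil; the
      transpose makes it an ordinary kernel vector.\<close>
    then have "transpose ?D *v v = 0"
      by (simp add: vec_mult_hcat_eq_0_iff pencil_output_feedback vector_matrix_mult_add_rdistrib
          flip: vector_matrix_mul_assoc)
    moreover have "det (transpose ?D) \<noteq> 0"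
      using det by simp
    ultimately show "v = 0"
      unfolding det_nonzero_iff_ker by blast
  qed
qed

section \<open>Dissipation\<close>

text \<open>Real and imaginary parts allow real quadratic forms to replace Hermitian ones.\<close>

definition Re_vec :: "complex^'n \<Rightarrow> real^'n" where "Re_vec x = (\<chi> i. Re (x $ i))"
definition Im_vec :: "complex^'n \<Rightarrow> real^'n" where "Im_vec x = (\<chi> i. Im (x $ i))"

lemma complex_vec_eq_0_iff: "x = 0 \<longleftrightarrow> Re_vec x = 0 \<and> Im_vec x = 0"
  by (auto simp: vec_eq_iff Re_vec_def Im_vec_def complex_eq_iff)

lemma cmat_mult_vec_eq_0_iff:
  "cmat M *v x = 0 \<longleftrightarrow> M *v Re_vec x = 0 \<and> M *v Im_vec x = 0"
proof -
  have "Re_vec (cmat M *v x) = M *v Re_vec x" "Im_vec (cmat M *v x) = M *v Im_vec x"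
    by (simp_all add: vec_eq_iff Re_vec_def Im_vec_def matrix_vector_mult_def)
  then show ?thesis
    by (simp add: complex_vec_eq_0_iff[of "cmat M *v x"])
qed

lemma pencil_mult_vec_eq_0_iff:
  "pencil E A s *v x = 0 \<longleftrightarrow>
     Re s *\<^sub>R (E *v Re_vec x) - Im s *\<^sub>R (E *v Im_vec x) = A *v Re_vec x \<and>
     Re s *\<^sub>R (E *v Im_vec x) + Im s *\<^sub>R (E *v Re_vec x) = A *v Im_vec x"
proof -
  have "Re_vec (pencil E A s *v x) =
      Re s *\<^sub>R (E *v Re_vec x) - Im s *\<^sub>R (E *v Im_vec x) - A *v Re_vec x"
    by (simp add: vec_eq_iff Re_vec_def pencil_def Im_vec_def matrix_vector_mult_def sum_distrib_left
        algebra_simps sum_subtractf sum.distrib)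
  moreover have "Im_vec (pencil E A s *v x) =
      Re s *\<^sub>R (E *v Im_vec x) + Im s *\<^sub>R (E *v Re_vec x) - A *v Im_vec x"
    by (simp add: vec_eq_iff Re_vec_def pencil_def Im_vec_def matrix_vector_mult_def sum_distrib_left
        algebra_simps sum_subtractf sum.distrib)
  ultimately show ?thesis
    by (simp add: complex_vec_eq_0_iff[of "pencil E A s *v x"])
qed

section \<open>Semidefinite forms and the energy balance\<close>

lemma inner_transpose_mult: "x \<bullet> (transpose M *v y) = (M *v x) \<bullet> (y :: real^'k)"
  by (metis dot_lmul_matrix inner_commute transpose_matrix_vector)

lemma psd_inner_commute: "psd W \<Longrightarrow> x \<bullet> (W *v y) = y \<bullet> (W *v x)"
  by (metis inner_commute inner_transpose_mult psd_def)

text \<open>If \<open>W *v x\<close> were nonzero, a small step from \<open>x\<close> against it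
  would make the form negative.\<close>

lemma psd_quadratic_form_eq_0:
  assumes "psd W" "x \<bullet> (W *v x) = 0"
  shows "W *v x = 0"
proof (rule ccontr)
  let ?y = "W *v x"
  let ?p = "?y \<bullet> ?y" and ?c = "?y \<bullet> (W *v ?y)"
  assume "?y \<noteq> 0"
  then have p: "?p > 0"
    by simp
  have c: "?c \<ge> 0"
    using assms(1) by (simp add: psd_def)
  \<comment> \<open>This size ensures \<open>t * ?c \<ge> - ?p\<close>, so
    \<open>2 * ?p + t * ?c\<close> stays positive while \<open>t\<close> is negative; adding 1
    covers \<open>?c = 0\<close>.\<close>
  define t where "t = - ?p / (?c + 1)"
  have "0 \<le> (x + t *\<^sub>R ?y) \<bullet> (W *v (x + t *\<^sub>R ?y))"
    using assms(1) by (simp add: psd_def)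
  also have "\<dots> = t * (2 * ?p + t * ?c)"
    using psd_inner_commute[OF assms(1), of x ?y] assms(2)
    by (simp add: matrix_vector_right_distrib matrix_vector_mult_scaleR
        inner_add_left inner_add_right algebra_simps)
  finally have "0 \<le> t * (2 * ?p + t * ?c)" .
  moreover have "t < 0"
    using p c by (simp add: t_def divide_neg_pos)
  moreover have "2 * ?p + t * ?c > 0"
  proof -
    have "?p * ?c / (?c + 1) \<le> ?p"
      using p c by (simp add: divide_simps)
    moreover have "t * ?c = - (?p * ?c / (?c + 1))"
      by (simp add: t_def)
    ultimately show ?thesis
      using p by linarith
  qed
  ultimately show False
    by (simp add: zero_le_mult_iff)
qed

text \<open>Multiply the two real kernel equations by \<open>transpose Q\<close>, pair them with
  \<open>Re_vec x\<close> and \<open>Im_vec x\<close>, and add: the cross terms with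
  \<open>Im s\<close> cancel because \<open>transpose Q ** E\<close> is symmetric.\<close>

lemma dissipative_pencil_kernel:
  fixes E A Q S :: "real^'n^'n"
  assumes "psd (transpose Q ** E)"
    and diss: "\<And>y. y \<bullet> ((transpose Q ** A) *v y) = - (y \<bullet> (S *v y))"
    and ker: "pencil E A s *v x = 0"
  shows "Re s * (Re_vec x \<bullet> ((transpose Q ** E) *v Re_vec x) +
      Im_vec x \<bullet> ((transpose Q ** E) *v Im_vec x)) =
    - (Re_vec x \<bullet> (S *v Re_vec x) + Im_vec x \<bullet> (S *v Im_vec x))"
proof -
  let ?u = "Re_vec x" and ?v = "Im_vec x" and ?W = "transpose Q ** E"
  have "transpose Q *v (Re s *\<^sub>R (E *v ?u) - Im s *\<^sub>R (E *v ?v)) = transpose Q *v (A *v ?u)"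
    "transpose Q *v (Re s *\<^sub>R (E *v ?v) + Im s *\<^sub>R (E *v ?u)) = transpose Q *v (A *v ?v)"
    using ker by (simp_all add: pencil_mult_vec_eq_0_iff)
  then have "Re s *\<^sub>R (?W *v ?u) - Im s *\<^sub>R (?W *v ?v) = (transpose Q ** A) *v ?u"
    "Re s *\<^sub>R (?W *v ?v) + Im s *\<^sub>R (?W *v ?u) = (transpose Q ** A) *v ?v"
    by (simp_all only: matrix_vector_right_distrib matrix_vector_mult_diff_distrib
        matrix_vector_mult_scaleR matrix_vector_mul_assoc)
  then have "?u \<bullet> (Re s *\<^sub>R (?W *v ?u) - Im s *\<^sub>R (?W *v ?v)) = - (?u \<bullet> (S *v ?u))"
    "?v \<bullet> (Re s *\<^sub>R (?W *v ?v) + Im s *\<^sub>R (?W *v ?u)) = - (?v \<bullet> (S *v ?v))"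
    by (simp_all only: diss)
  then show ?thesis
    using psd_inner_commute[OF assms(1), of ?u ?v]
    by (simp add: inner_diff_right inner_add_right algebra_simps)
qed

section \<open>Output feedback in port-Hamiltonian systems\<close>

lemma transpose_add: "transpose (X + Y) = transpose X + transpose Y"
  by (simp add: transpose_def vec_eq_iff)

lemma transpose_diff: "transpose (X - Y) = transpose X - transpose Y"
  by (simp add: transpose_def vec_eq_iff)

lemma matrix_diff_ldistrib: "X ** (Y - Z) = X ** Y - X ** (Z :: 'a::ring_1^'k^'l)"
  by (simp add: vec_eq_iff matrix_matrix_mult_def sum_subtractf algebra_simps)

lemma matrix_diff_rdistrib: "(X - Y) ** Z = X ** Z - Y ** (Z :: 'a::ring_1^'k^'l)"
  by (simp add: vec_eq_iff matrix_matrix_mult_def sum_subtractf algebra_simps)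

lemma matrix_add_rdistrib: "(X + Y) ** Z = X ** Z + Y ** (Z :: 'a::semiring_1^'k^'l)"
  by (simp add: vec_eq_iff matrix_matrix_mult_def sum.distrib distrib_right)

text \<open>Transposing \<open>transpose Q ** P = 0\<close> gives
  \<open>transpose P ** Q = 0\<close>, so \<open>transpose (G + P) ** Q\<close> and
  \<open>transpose (G - P) ** Q\<close> agree.\<close>

lemma pH_representation_output:
  assumes "pH_representation E A B C J R Q G P"
  shows "C = transpose B ** Q"
proof -
  have "transpose P ** Q = transpose (transpose Q ** P)"
    by (simp add: matrix_transpose_mul)
  also have "\<dots> = 0"
    using assms by (simp add: pH_representation_def transpose_def vec_eq_iff)
  finally show ?thesis
    using assms
    by (simp add: pH_representation_def transpose_add transpose_diff matrix_add_rdistrib matrix_diff_rdistrib)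
qed

text \<open>Multiplying \<open>A = (J - R) ** Q\<close> by \<open>transpose Q\<close> splits it into
  a skew part, whose quadratic form vanishes, and the damping part.\<close>

lemma pH_representation_dissipation:
  assumes "pH_representation E A B C J R Q G P"
  shows "y \<bullet> ((transpose Q ** A) *v y) = - (y \<bullet> ((transpose Q ** R ** Q) *v y))"
proof -
  let ?S = "transpose Q ** J ** Q"
  have "y \<bullet> (?S *v y) = y \<bullet> ((- transpose ?S) *v y)"
    using assms by (simp add: pH_representation_def)
  also have "(- transpose ?S) *v y = - (transpose ?S *v y)"
    by (simp add: vec_eq_iff matrix_vector_mult_def sum_negf)
  also have "y \<bullet> (- (transpose ?S *v y)) = - (y \<bullet> (?S *v y))"
    by (simp only: inner_minus_right inner_transpose_mult inner_commute)
  finally have skew: "y \<bullet> (?S *v y) = 0"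
    by simp
  have "transpose Q ** A = ?S - transpose Q ** R ** Q"
    using assms
    by (simp add: pH_representation_def matrix_diff_rdistrib matrix_diff_ldistrib matrix_mul_assoc)
  then show ?thesis
    using skew by (simp add: matrix_vector_mult_diff_rdistrib inner_diff_right)
qed

lemma quadratic_form_congruence:
  "y \<bullet> ((transpose C ** K ** C) *v y) = (C *v y) \<bullet> (K *v (C *v y))" for K :: "real^'m^'m"
  by (simp only: inner_transpose_mult flip: matrix_vector_mul_assoc)

lemma psd_congruence:
  assumes "psd K"
  shows "psd (transpose C ** K ** C)"
proof -
  have "transpose (transpose C ** K ** C) = transpose C ** K ** C"
    using assms by (simp add: psd_def matrix_transpose_mul matrix_mul_assoc)
  then show ?thesis
    using assms unfolding psd_def quadratic_form_congruence by blast
qed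

lemma psd_add: "psd X \<Longrightarrow> psd Y \<Longrightarrow> psd (X + Y)"
  by (simp add: psd_def transpose_add matrix_vector_mult_add_rdistrib inner_add_right)

lemma spd_imp_psd: "spd K \<Longrightarrow> psd K"
  unfolding spd_def psd_def by (metis inner_zero_left less_eq_real_def)

lemma pH_output_feedback_damping:
  assumes "pH_representation E A B C J R Q G P"
  shows "transpose Q ** (R + B ** K ** transpose B) ** Q = transpose Q ** R ** Q + transpose C ** K ** C"
  unfolding pH_representation_output[OF assms]
  by (simp add: matrix_transpose_mul matrix_add_ldistrib matrix_add_rdistrib matrix_mul_assoc)

text \<open>Only \<open>R\<close> changes, so just two conditions need checking: the factorisation
  of the state matrix, and semidefiniteness of the damping, which gains the semidefinite term
  \<open>transpose C ** K ** C\<close>.\<close>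

lemma pH_representation_output_feedback:
  assumes pH: "pH_representation E A B C J R Q G P" and K: "psd K"
  shows "pH_representation E (A - B ** K ** C) B C J (R + B ** K ** transpose B) Q G P"
proof -
  have "A - B ** K ** C = (J - (R + B ** K ** transpose B)) ** Q"
    using pH pH_representation_output[OF pH]
    by (simp add: pH_representation_def matrix_diff_rdistrib matrix_add_rdistrib matrix_mul_assoc)
  moreover have "psd (transpose Q ** R ** Q + transpose C ** K ** C)"
    using pH K unfolding pH_representation_def by (blast intro: psd_add psd_congruence)
  ultimately show ?thesis
    using pH unfolding pH_representation_def pH_output_feedback_damping[OF pH] by blast
qed

section \<open>Sufficiency of the rank conditions\<close>

lemma good_feedback_if_rank_conditions:
  fixes E A :: "real^'n^'n" and B :: "real^'m^'n" and C :: "real^'n^'m" and K :: "real^'m^'m"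
  assumes pH: "admits_pH E A B C" and inf: "rank_condition_infinity E A C"
    and imag: "rank_condition_imaginary_axis E A B C" and K: "spd K"
  shows "good_feedback E A B C K"
proof -
  obtain J R Q G P where rep: "pH_representation E A B C J R Q G P"
    using pH unfolding admits_pH_def by blast
  let ?A = "A - B ** K ** C"
  let ?W = "transpose Q ** E" and ?S = "transpose Q ** R ** Q + transpose C ** K ** C"
  have rep': "pH_representation E ?A B C J (R + B ** K ** transpose B) Q G P"
    by (rule pH_representation_output_feedback[OF rep spd_imp_psd[OF K]])
  have W: "psd ?W" and S: "psd ?S"
    using rep' unfolding pH_representation_def pH_output_feedback_damping[OF rep] by blast+
  have diss: "y \<bullet> ((transpose Q ** ?A) *v y) = - (y \<bullet> (?S *v y))" for y
    using pH_representation_dissipation[OF rep'] by (simp only: pH_output_feedback_damping[OF rep])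
  have S_pos: "0 \<le> y \<bullet> (?S *v y)" and W_pos: "0 \<le> y \<bullet> (?W *v y)" for y
    using S W by (simp_all add: psd_def)
  \<comment> \<open>The form is a sum of two nonnegative terms, and by definiteness of
    \<open>K\<close> the second vanishes only if \<open>C *v y = 0\<close>.\<close>
  have C0: "C *v y = 0" if "y \<bullet> (?S *v y) = 0" for y
  proof -
    have "y \<bullet> ((transpose Q ** R ** Q) *v y) + (C *v y) \<bullet> (K *v (C *v y)) = 0"
      using that by (simp only: matrix_vector_mult_add_rdistrib inner_add_right quadratic_form_congruence)
    moreover have "0 \<le> y \<bullet> ((transpose Q ** R ** Q) *v y)"
      using rep by (simp add: pH_representation_def psd_def)
    ultimately have "(C *v y) \<bullet> (K *v (C *v y)) \<le> 0"
      by linarith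
    then show ?thesis
      using K unfolding spd_def by (meson not_less)
  qed
  have AK: "?A *v y = A *v y" if "C *v y = 0" for y
    using that by (simp add: matrix_vector_mult_diff_rdistrib flip: matrix_vector_mul_assoc)
  have obs: "x = 0" if "Re s = 0" "pencil E A s *v x = 0" "cmat C *v x = 0" for s x
    using imag that unfolding rank_condition_imaginary_axis_def rank_eq_columns_iff_ker vcat_mult_vec_eq_0_iff
    by blast
  have obs0: "y = 0" if "A *v y = 0" "C *v y = 0" for y
  proof -
    \<comment> \<open>A real \<open>y\<close> is read as a complex vector so that the rank condition
      at \<open>s = 0\<close>, where the pencil is \<open>- A\<close>, applies.\<close>
    let ?x = "(\<chi> i. complex_of_real (y $ i)) :: complex^'n"
    have x: "Re_vec ?x = y" "Im_vec ?x = 0"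
      by (simp_all add: Re_vec_def Im_vec_def vec_eq_iff)
    have "?x = 0"
      by (rule obs[of 0]) (use that in \<open>simp_all add: pencil_mult_vec_eq_0_iff cmat_mult_vec_eq_0_iff x\<close>)
    then show ?thesis
      using x(1) complex_vec_eq_0_iff by metis
  qed
  \<comment> \<open>Both \<open>A\<close> and \<open>C\<close> factor through \<open>Q\<close>, so
    the kernel of \<open>Q\<close> lies in their common kernel, which \<open>obs0\<close> shows to
    be trivial.\<close>
  have "y = 0" if "Q *v y = 0" for y
  proof (rule obs0)
    show "A *v y = 0"
      using rep that by (simp add: pH_representation_def flip: matrix_vector_mul_assoc)
    show "C *v y = 0"
      using that by (simp add: pH_representation_output[OF rep] flip: matrix_vector_mul_assoc)
  qed
  then have "det (transpose Q) \<noteq> 0"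
    by (simp add: det_nonzero_iff_ker)
  then have QT: "y = 0" if "transpose Q *v y = 0" for y
    using that unfolding det_nonzero_iff_ker by blast
  have stable: "det (pencil E ?A s) \<noteq> 0" if s: "0 \<le> Re s" for s
    unfolding det_nonzero_iff_ker
  proof (intro allI impI)
    fix x
    assume x: "pencil E ?A s *v x = 0"
    let ?u = "Re_vec x" and ?v = "Im_vec x"
    have eq: "Re s * (?u \<bullet> (?W *v ?u) + ?v \<bullet> (?W *v ?v)) = - (?u \<bullet> (?S *v ?u) + ?v \<bullet> (?S *v ?v))"
      by (rule dissipative_pencil_kernel[OF W diss x])
    \<comment> \<open>The left side of \<open>eq\<close> is nonnegative and the right side
      nonpositive, so both damping terms vanish.\<close>
    have "0 \<le> Re s * (?u \<bullet> (?W *v ?u) + ?v \<bullet> (?W *v ?v))"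
      using s W_pos by (simp add: add_nonneg_nonneg)
    then have "?u \<bullet> (?S *v ?u) = 0" "?v \<bullet> (?S *v ?v) = 0"
      using eq S_pos[of ?u] S_pos[of ?v] by linarith+
    then have C: "C *v ?u = 0" "C *v ?v = 0"
      by (auto intro: C0)
    have A: "?A *v ?u = A *v ?u" "?A *v ?v = A *v ?v"
      using C AK by blast+
    show "x = 0"
    proof (cases "Re s = 0")
      case True
      then show ?thesis
        by (rule obs[of s]) (use x C in \<open>simp_all add: pencil_mult_vec_eq_0_iff cmat_mult_vec_eq_0_iff A\<close>)
    next
      case False
      \<comment> \<open>For positive \<open>Re s\<close> the stored energy vanishes too. Cancelling
        \<open>transpose Q\<close> leaves \<open>E\<close>, and hence \<open>A\<close>, zero on both
        parts, so \<open>obs0\<close> applies.\<close>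
      have "?u \<bullet> (?W *v ?u) + ?v \<bullet> (?W *v ?v) = 0"
        using eq False \<open>?u \<bullet> (?S *v ?u) = 0\<close> \<open>?v \<bullet> (?S *v ?v) = 0\<close> by simp
      then have "?u \<bullet> (?W *v ?u) = 0" "?v \<bullet> (?W *v ?v) = 0"
        using W_pos[of ?u] W_pos[of ?v] by linarith+
      then have "?W *v ?u = 0" "?W *v ?v = 0"
        using psd_quadratic_form_eq_0[OF W] by blast+
      then have E: "E *v ?u = 0" "E *v ?v = 0"
        by (metis QT matrix_vector_mul_assoc)+
      then have "A *v ?u = 0" "A *v ?v = 0"
        using x unfolding pencil_mult_vec_eq_0_iff A by simp_all
      then show ?thesis
        using C obs0 by (simp add: complex_vec_eq_0_iff)
    qed
  qed
  have "regular_impulse_free E ?A"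
    unfolding regular_impulse_free_iff
  proof (intro allI impI)
    fix x z
    assume x: "E *v x = 0" "?A *v x = E *v z"
    \<comment> \<open>Symmetry of \<open>?W\<close> moves \<open>E\<close> from \<open>z\<close> to
      \<open>x\<close>, where it vanishes; \<open>diss\<close> and \<open>C0\<close> then give
      \<open>C *v x = 0\<close>.\<close>
    have "x \<bullet> ((transpose Q ** ?A) *v x) = x \<bullet> (?W *v z)"
      using x(2) by (simp only: flip: matrix_vector_mul_assoc)
    also have "\<dots> = z \<bullet> (?W *v x)"
      by (rule psd_inner_commute[OF W])
    also have "\<dots> = 0"
      using x(1) by (simp flip: matrix_vector_mul_assoc)
    finally have "C *v x = 0"
      using diss C0 by simp
    moreover have "A *v x = E *v z"
      using x(2) AK[OF \<open>C *v x = 0\<close>] by simp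
    ultimately show "x = 0"
      using inf x(1) unfolding rank_condition_infinity_iff by blast
  qed
  moreover have "regular E ?A"
    unfolding regular_def using stable[of 0] by auto
  moreover have "\<forall>s. det (pencil E ?A s) = 0 \<longrightarrow> Re s < 0"
    using stable not_less by blast
  ultimately show ?thesis
    using rep' unfolding good_feedback_def regular_asymp_stable_def admits_pH_def by blast
qed

text \<open>The identity serves as the feedback that yields (a) from (b).\<close>

lemma spd_mat_1: "spd (mat 1)"
  by (simp add: spd_def)

theorem theorem3p1:
  fixes E A :: "real^'n^'n" and B :: "real^'m^'n" and C :: "real^'n^'m"
  assumes "admits_pH E A B C"
  shows "((\<exists>K :: real^'m^'m. good_feedback E A B C K) \<longleftrightarrow>
          rank_condition_infinity E A C \<and> rank_condition_imaginary_axis E A B C) \<and>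
         (rank_condition_infinity E A C \<and> rank_condition_imaginary_axis E A B C \<longrightarrow>
          (\<forall>K :: real^'m^'m. spd K \<longrightarrow> good_feedback E A B C K))"
proof -
  have "rank_condition_infinity E A C \<and> rank_condition_imaginary_axis E A B C"
    if "good_feedback E A B C K" for K
    using that rank_condition_infinity_if_impulse_free rank_condition_imaginary_axis_if_asymp_stable
    unfolding good_feedback_def by metis
  then show ?thesis
    using good_feedback_if_rank_conditions[OF assms] spd_mat_1 by metis
qed

end
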